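(* Let $X$ be a simplicial complex, and let $1\le r\le \dim(X)$. Then, for all $1\le k\le f_{r-1}(X)$, \[ \sum_{i=1}^{k} \lambda_i(L_{r-1}^{+}(X)) \le f_{r}(X) + \binom{(r+1)k}{2}. \]
   Context: A simplicial complex $X$ on a finite vertex set $V$ is a family of subsets of $V$ closed under inclusion; its elements are called simplices (or faces), $\dim(\sigma)=|\sigma|-1$ for $\sigma\in X$, and $\dim(X)$ is the maximal dimension of a simplex. $X(i)$ is the set of $i$-dimensional simplices (with $X(-1)=\{\emptyset\}$) and $f_i(X)=|X(i)|$. For $\sigma\in X$ and $1\le r\le\dim(X)$, the $r$-degree $\deg_X^{(r)}(\sigma)$ is the number of $r$-dimensional simplices of $X$ containing $\sigma$. Fix an arbitrary linear order $<$ on $V$. For $\sigma\in X(s-1)$, $\tau\in X(s)$ with $\sigma\subset\tau$ ($0\le s\le \dim(X)$), let $u$ be the unique vertex of $\tau\setminus\sigma$ and set $(\tau:\sigma)=(-1)^{|\{v\in\tau:\,v<u\}|}$. For $1\le r\le\dim(X)$, the upper Laplacian $L_{r-1}^+(X)\in\mathbb{R}^{f_{r-1}(X)\times f_{r-1}(X)}$ is the matrix indexed by $X(r-1)$ with $L_{r-1}^+(X)_{\tau,\tau}=\deg_X^{(r)}(\tau)$; $L_{r-1}^+(X)_{\tau,\eta}=-(\tau:\tau\cap\eta)(\eta:\tau\cap\eta)$ if $|\tau\cap\eta|=r-1$ and $\tau\cup\eta\in X$; and all other entries $0$. For a symmetric real matrix $M$, $\lambda_i(M)$ is its $i$-th largest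 eigenvalue (with multiplicity). *)

theory Defs
  imports
    "HOL-Library.Multiset"
    "HOL-Computational_Algebra.Polynomial"
    "Jordan_Normal_Form.Char_Poly"
begin

(* The empty face is required, in accordance with X(-1) = {{}}. *)
definition simplicial_complex :: "'a set \<Rightarrow> 'a set set \<Rightarrow> bool" where
  "simplicial_complex V X \<longleftrightarrow>
     finite V \<and> X \<subseteq> Pow V \<and> {} \<in> X \<and> (\<forall>\<sigma>\<in>X. \<forall>\<tau>. \<tau> \<subseteq> \<sigma> \<longrightarrow> \<tau> \<in> X)"

definition simplex_dim :: "'a set \<Rightarrow> int" where
  "simplex_dim \<sigma> = int (card \<sigma>) - 1"

definition complex_dim :: "'a set set \<Rightarrow> int" where
  "complex_dim X = Max (simplex_dim ` X)"

definition faces :: "'a set set \<Rightarrow> int \<Rightarrow> 'a set set" where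
  "faces X i = {\<sigma> \<in> X. simplex_dim \<sigma> = i}"

definition face_number :: "'a set set \<Rightarrow> int \<Rightarrow> nat" where
  "face_number X i = card (faces X i)"

definition face_degree :: "'a set set \<Rightarrow> nat \<Rightarrow> 'a set \<Rightarrow> nat" where
  "face_degree X r \<sigma> = card {\<rho> \<in> faces X (int r). \<sigma> \<subseteq> \<rho>}"

(* incidence_sign \<tau> \<sigma> is (\<tau>:\<sigma>); it is only meaningful if \<sigma> is a facet of \<tau>. *)
definition incidence_sign :: "'a::linorder set \<Rightarrow> 'a set \<Rightarrow> real" where
  "incidence_sign \<tau> \<sigma> = (-1) ^ card {v \<in> \<tau>. v < the_elem (\<tau> - \<sigma>)}"

definition upper_laplacian_entry ::
  "'a::linorder set set \<Rightarrow> nat \<Rightarrow> 'a set \<Rightarrow> 'a set \<Rightarrow> real" where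
  "upper_laplacian_entry X r \<tau> \<eta> =
     (if \<tau> = \<eta> then real (face_degree X r \<tau>)
      else if card (\<tau> \<inter> \<eta>) = r - 1 \<and> \<tau> \<union> \<eta> \<in> X
      then - incidence_sign \<tau> (\<tau> \<inter> \<eta>) * incidence_sign \<eta> (\<tau> \<inter> \<eta>)
      else 0)"

(* The matrix of the upper Laplacian in degree r - 1 (note the index shift), its rows and
   columns being numbered by an enumeration fs of the (r-1)-dimensional faces. *)
definition upper_laplacian :: "'a::linorder set set \<Rightarrow> nat \<Rightarrow> 'a set list \<Rightarrow> real mat" where
  "upper_laplacian X r fs =
     mat (length fs) (length fs) (\<lambda>(i, j). upper_laplacian_entry X r (fs ! i) (fs ! j))"

(* For i = 1, ..., n, the i-th largest eigenvalue, counted with multiplicity, of a symmetric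
   real n x n matrix; its characteristic polynomial splits over the reals. *)
definition nth_largest_eigenvalue :: "real mat \<Rightarrow> nat \<Rightarrow> real" where
  "nth_largest_eigenvalue M i = rev (sorted_list_of_multiset (proots (char_poly M))) ! (i - 1)"

end

theory Submission
  imports Defs "HOL-Analysis.L2_Norm"
begin

text \<open>
  Let B be the signed incidence matrix between the (r-1)-faces \<open>\<tau>\<close> and the r-faces, so that the
  Laplacian is \<open>B B\<^sup>T\<close>, and let \<open>\<lambda>\<^sub>i\<close>, \<open>u\<^sub>i\<close> be its eigenvalues and orthonormal eigenvectors. The
  weights \<open>h \<tau> = (\<Sum>i\<le>k. \<lambda>\<^sub>i u\<^sub>i(\<tau>)\<^sup>2) / deg \<tau>\<close> are at most 1, because the same sum over all i is
  the diagonal entry \<open>deg \<tau>\<close>. The Cauchy-Schwarz inequality applied to \<open>\<lambda>\<^sub>i u\<^sub>i = B (B\<^sup>T u\<^sub>i)\<close>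
  shows that they add up to at most m = (r+1)k. Hence the sum of k eigenvalues is
  \<open>\<Sum>\<tau>. deg \<tau> * h \<tau>\<close>, which is at most the sum of the degrees of some m faces. An r-face that
  contains c of these is counted \<open>c \<le> 1 + (c choose 2)\<close> times, and two (r-1)-faces lie in at
  most one common r-face, so the sum of the degrees is at most \<open>f\<^sub>r + (m choose 2)\<close>.
\<close>

section \<open>Spectral decomposition of symmetric real matrices\<close>

lemma symmetric_mat_index:
  assumes "A \<in> carrier_mat n n" "transpose_mat A = A" "i < n" "j < n"
  shows "A $$ (i, j) = A $$ (j, i)"
  using assms by (metis carrier_matD index_transpose_mat(1))

text \<open>For an eigenvector \<open>v\<close>, the Hermitian form \<open>q\<close>, that is v* A
  v, equals \<open>a\<close> times the squared norm \<open>s\<close> of \<open>v\<close>.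
  Conjugating \<open>q\<close> and swapping the two summations gives \<open>q\<close> back because
  \<open>A\<close> is real and symmetric, so \<open>a\<close> is a quotient of reals.\<close>

lemma symmetric_eigenvalue_real:
  fixes A :: "real mat"
  assumes A: "A \<in> carrier_mat n n" and sym: "transpose_mat A = A"
    and ev: "eigenvalue (map_mat complex_of_real A) a"
  shows "a \<in> \<real>"
proof -
  obtain v where v: "v \<in> carrier_vec n" "v \<noteq> 0\<^sub>v n"
    and Av: "map_mat complex_of_real A *\<^sub>v v = a \<cdot>\<^sub>v v"
    using ev A unfolding eigenvalue_def eigenvector_def by auto
  have row: "(\<Sum>j<n. of_real (A $$ (i, j)) * v $ j) = a * v $ i" if "i < n" for i
    using arg_cong[OF Av, of "\<lambda>w. w $ i"] that A v(1)
    by (auto simp: scalar_prod_def atLeast0LessThan)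
  define q where "q = (\<Sum>i<n. \<Sum>j<n. of_real (A $$ (i, j)) * cnj (v $ i) * v $ j)"
  define s where "s = (\<Sum>i<n. (cmod (v $ i))\<^sup>2)"
  have q: "q = a * of_real s"
  proof -
    have "q = (\<Sum>i<n. cnj (v $ i) * (\<Sum>j<n. of_real (A $$ (i, j)) * v $ j))"
      unfolding q_def by (simp add: sum_distrib_left mult_ac)
    also have "\<dots> = (\<Sum>i<n. a * (v $ i * cnj (v $ i)))"
      by (intro sum.cong) (simp_all add: row)
    also have "\<dots> = a * of_real s"
      unfolding s_def by (simp add: sum_distrib_left complex_norm_square del: of_real_power)
    finally show ?thesis .
  qed
  have "cnj q = (\<Sum>i<n. \<Sum>j<n. of_real (A $$ (i, j)) * v $ i * cnj (v $ j))"
    unfolding q_def by simp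
  also have "\<dots> = (\<Sum>j<n. \<Sum>i<n. of_real (A $$ (i, j)) * v $ i * cnj (v $ j))"
    by (rule sum.swap)
  also have "\<dots> = q"
    unfolding q_def using symmetric_mat_index[OF A sym]
    by (intro sum.cong refl) (simp add: mult_ac)
  finally have "q \<in> \<real>" by (simp add: Reals_cnj_iff)
  moreover have "s \<noteq> 0"
  proof
    assume "s = 0"
    hence "\<forall>i<n. v $ i = 0" unfolding s_def by (subst (asm) sum_nonneg_eq_0_iff) auto
    thus False using v by (auto simp: vec_eq_iff)
  qed
  ultimately have "q / of_real s \<in> \<real>" by (intro Reals_divide) auto
  thus ?thesis using q \<open>s \<noteq> 0\<close> by simp
qed

text \<open>Over the complex numbers the characteristic polynomial factors, and all its roots are
  real by the previous lemma. The factorization is therefore the image of a real one, and it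
  descends because the embedding of the reals is injective on coefficients.\<close>

lemma symmetric_char_poly_splits:
  fixes A :: "real mat"
  assumes A: "A \<in> carrier_mat n n" and sym: "transpose_mat A = A"
  shows "\<exists>es. char_poly A = (\<Prod>e\<leftarrow>es. [:- e, 1:])"
proof -
  define C where "C = map_mat complex_of_real A"
  have C: "C \<in> carrier_mat n n" unfolding C_def using A by simp
  obtain as where as: "char_poly C = (\<Prod>a\<leftarrow>as. [:- a, 1:])"
    using char_poly_factorized[OF C] by blast
  have "a \<in> \<real>" if "a \<in> set as" for a
  proof -
    have "poly (char_poly C) a = 0"
      unfolding as poly_prod_list using that by (auto simp: prod_list_zero_iff)
    thus ?thesis
      using symmetric_eigenvalue_real[OF A sym] eigenvalue_root_char_poly[OF C]
      unfolding C_def by blast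
  qed
  hence re: "\<forall>a\<in>set as. a = of_real (Re a)" by (simp add: complex_is_Real_iff complex_eq_iff)
  interpret P: map_poly_comm_ring_hom complex_of_real ..
  have prod: "map_poly complex_of_real (\<Prod>e\<leftarrow>map Re bs. [:- e, 1:]) = (\<Prod>a\<leftarrow>bs. [:- a, 1:])"
    if "\<forall>a\<in>set bs. a = of_real (Re a)" for bs
    using that
  proof (induction bs)
    case (Cons a bs)
    have "map_poly complex_of_real [:- Re a, 1:] = [:- a, 1:]"
      using Cons.prems by (simp add: map_poly_pCons)
    with Cons show ?case
      by (simp only: list.map prod_list.Cons P.hom_mult) simp
  qed simp
  have "map_poly complex_of_real (char_poly A) = char_poly C"
    unfolding C_def by (simp add: of_real_hom.char_poly_hom[OF A])
  hence "map_poly complex_of_real (char_poly A)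
      = map_poly complex_of_real (\<Prod>e\<leftarrow>map Re as. [:- e, 1:])"
    using as prod[OF re] by simp
  hence "char_poly A = (\<Prod>e\<leftarrow>map Re as. [:- e, 1:])"
    by (simp only: poly_eq_iff coeff_map_poly of_real_0 of_real_eq_iff simp_thms)
  thus ?thesis by blast
qed

text \<open>\<open>H\<close> is the reflection in the hyperplane orthogonal to \<open>w\<close>, the
  difference of \<open>v\<close> and the first unit vector; it exchanges these two vectors. Being a
  symmetric involution it is orthogonal, so it serves as an orthonormal basis that starts with a
  given unit vector.\<close>

lemma householder:
  fixes v :: "real vec"
  assumes v: "v \<in> carrier_vec (Suc n)" and unit: "v \<bullet> v = 1"
  shows "\<exists>H \<in> carrier_mat (Suc n) (Suc n). transpose_mat H = H \<and> H * H = 1\<^sub>m (Suc n)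
           \<and> H *\<^sub>v v = unit_vec (Suc n) 0"
proof -
  \<comment> \<open>If v is already the unit vector, then w = 0 and c = 2 / 0 = 0, so that H is the identity.\<close>
  define w where "w i = v $ i - (if i = 0 then 1 else 0)" for i
  define c where "c = 2 / (\<Sum>l\<le>n. (w l)\<^sup>2)"
  define H where "H = mat (Suc n) (Suc n) (\<lambda>(i, j). (if i = j then 1 else 0) - c * w i * w j)"
  have vv: "(\<Sum>l\<le>n. (v $ l)\<^sup>2) = 1"
    using unit v by (simp add: scalar_prod_def power2_eq_square atLeast0LessThan lessThan_Suc_atMost)
  have delta: "(\<Sum>l\<le>n. (if i = l then 1 else 0) * f l) = f i" if "i < Suc n" for i and f :: "nat \<Rightarrow> real"
  proof -
    have "(\<Sum>l\<le>n. (if i = l then 1 else 0) * f l) = (\<Sum>l\<le>n. if i = l then f l else 0)"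
      by (intro sum.cong) auto
    thus ?thesis using that by simp
  qed
  have ww: "(\<Sum>l\<le>n. (w l)\<^sup>2) = 2 - 2 * v $ 0"
  proof -
    have "(w l)\<^sup>2 = (v $ l)\<^sup>2 + (if 0 = l then 1 else 0) * (1 - 2 * v $ l)" for l
      unfolding w_def by (auto simp: power2_eq_square algebra_simps)
    thus ?thesis using vv delta[of 0 "\<lambda>l. 1 - 2 * v $ l"] by (simp add: sum.distrib)
  qed
  have wv: "(\<Sum>l\<le>n. w l * v $ l) = 1 - v $ 0"
  proof -
    have "w l * v $ l = (v $ l)\<^sup>2 - (if 0 = l then 1 else 0) * v $ l" for l
      unfolding w_def by (auto simp: power2_eq_square algebra_simps)
    thus ?thesis using vv delta[of 0 "\<lambda>l. v $ l"] by (simp add: sum_subtractf)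
  qed
  have H: "H \<in> carrier_mat (Suc n) (Suc n)" unfolding H_def by simp
  moreover have "transpose_mat H = H"
    unfolding H_def by (intro eq_matI) auto
  moreover have "H * H = 1\<^sub>m (Suc n)"
  proof (intro eq_matI)
    fix i j assume "i < dim_row (1\<^sub>m (Suc n) :: real mat)" "j < dim_col (1\<^sub>m (Suc n) :: real mat)"
    hence ij: "i < Suc n" "j < Suc n" by auto
    have "(H * H) $$ (i, j) = (\<Sum>l\<le>n. H $$ (i, l) * H $$ (l, j))"
      using ij H by (simp add: scalar_prod_def atLeast0LessThan lessThan_Suc_atMost)
    also have "\<dots> = (\<Sum>l\<le>n. (if i = l then 1 else 0) * ((if l = j then 1 else 0) - c * w l * w j)
        - (if j = l then 1 else 0) * (c * w i * w l) + c * c * w i * w j * (w l)\<^sup>2)"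
      using ij unfolding H_def
      by (intro sum.cong) (auto simp: power2_eq_square algebra_simps)
    also have "\<dots> = (if i = j then 1 else 0) - 2 * c * w i * w j + c * (c * (\<Sum>l\<le>n. (w l)\<^sup>2)) * w i * w j"
      using ij by (simp add: sum.distrib sum_subtractf delta flip: sum_distrib_left)
    \<comment> \<open>Either \<open>c\<close> times the squared norm of \<open>w\<close> is 2 and
      the last two terms cancel, or \<open>w\<close> has norm 0 and both vanish with
      \<open>c\<close>.\<close>
    also have "\<dots> = (if i = j then 1 else 0)"
      by (simp add: c_def)
    finally show "(H * H) $$ (i, j) = 1\<^sub>m (Suc n) $$ (i, j)" using ij by simp
  qed (use H in auto)
  moreover have "H *\<^sub>v v = unit_vec (Suc n) 0"
  proof (intro eq_vecI)
    fix i assume "i < dim_vec (unit_vec (Suc n) 0 :: real vec)"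
    hence i: "i < Suc n" by simp
    have "(H *\<^sub>v v) $ i = (\<Sum>l\<le>n. H $$ (i, l) * v $ l)"
      using i H v by (simp add: scalar_prod_def atLeast0LessThan lessThan_Suc_atMost)
    also have "\<dots> = (\<Sum>l\<le>n. (if i = l then 1 else 0) * v $ l - c * w i * (w l * v $ l))"
      using i unfolding H_def by (intro sum.cong) (auto simp: algebra_simps)
    also have "\<dots> = v $ i - c * (1 - v $ 0) * w i"
      using i by (simp add: sum_subtractf delta wv flip: sum_distrib_left)
    also have "c * (1 - v $ 0) * w i = w i"
    \<comment> \<open>By \<open>ww\<close>, the value 1 forces \<open>w\<close> to vanish; for any
      other value \<open>c\<close> is the inverse of \<open>1 - v $ 0\<close>.\<close>
    proof (cases "v $ 0 = 1")
      case True
      hence "\<forall>l\<le>n. w l = 0" using ww by (simp add: sum_nonneg_eq_0_iff)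
      thus ?thesis using i by simp
    next
      case False
      thus ?thesis unfolding c_def ww by (simp add: field_simps)
    qed
    finally show "(H *\<^sub>v v) $ i = unit_vec (Suc n) 0 $ i"
      using i by (auto simp: w_def)
  qed (use H in auto)
  ultimately show ?thesis by blast
qed

lemma exists_unit_eigenvector:
  fixes A :: "real mat"
  assumes A: "A \<in> carrier_mat n n" and ev: "eigenvalue A e"
  shows "\<exists>v \<in> carrier_vec n. v \<bullet> v = 1 \<and> A *\<^sub>v v = e \<cdot>\<^sub>v v"
proof -
  obtain v where v: "v \<in> carrier_vec n" "v \<noteq> 0\<^sub>v n" and Av: "A *\<^sub>v v = e \<cdot>\<^sub>v v"
    using ev A unfolding eigenvalue_def eigenvector_def by auto
  have pos: "v \<bullet> v > 0"
    using v by (metis conjugate_square_greater_0_vec conjugate_vec_def conjugate_real_def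
        conjugate_id vec_conjugate_real)
  define u where "u = (1 / sqrt (v \<bullet> v)) \<cdot>\<^sub>v v"
  have "u \<in> carrier_vec n" unfolding u_def using v by simp
  moreover have "u \<bullet> u = 1" unfolding u_def using v pos by simp
  moreover have "A *\<^sub>v u = e \<cdot>\<^sub>v u"
    unfolding u_def using A v Av by (simp add: mult_mat_vec smult_smult_assoc mult.commute)
  ultimately show ?thesis by blast
qed

text \<open>Deflation: a reflection \<open>H\<close> moves a unit eigenvector for \<open>e\<close>
  to the first coordinate, which splits off a 1 x 1 block and leaves a symmetric \<open>D\<close>
  whose roots are the rest of the list. If \<open>Q\<close> diagonalizes \<open>D\<close>, then
  \<open>H\<close> times the block sum of 1 and \<open>Q\<close> diagonalizes \<open>A\<close>. The
  diagonal follows the order of the given list, so the caller can choose that order.\<close>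

lemma symmetric_diagonalization:
  fixes A :: "real mat"
  assumes "A \<in> carrier_mat n n" "transpose_mat A = A"
    and "char_poly A = (\<Prod>e\<leftarrow>es. [:- e, 1:])"
  shows "\<exists>P \<in> carrier_mat n n. transpose_mat P * P = 1\<^sub>m n
           \<and> transpose_mat P * A * P = mat_diag n (\<lambda>i. es ! i)"
  using assms
proof (induction es arbitrary: n A)
  case Nil
  have "n = 0"
    using degree_monic_char_poly[OF Nil(1)] Nil(3) by simp
  thus ?case using Nil(1) by (intro bexI[of _ "1\<^sub>m n"]) (auto intro!: eq_matI simp: mat_diag_def)
next
  case (Cons e es m A)
  have "degree (\<Prod>e\<leftarrow>e # es. [:- e, 1:]) = m"
    using degree_monic_char_poly[OF Cons.prems(1)] Cons.prems(3) by simp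
  hence "m = length (e # es)" by (simp only: degree_linear_factors)
  then obtain n where m: "m = Suc n" by simp
  note A = Cons.prems(1)[unfolded m] and sym = Cons.prems(2)
  have "poly (char_poly A) e = 0"
    unfolding Cons.prems(3) poly_prod_list by simp
  hence "eigenvalue A e" using eigenvalue_root_char_poly[OF A] by blast
  then obtain v where v: "v \<in> carrier_vec (Suc n)" "v \<bullet> v = 1" and Av: "A *\<^sub>v v = e \<cdot>\<^sub>v v"
    using exists_unit_eigenvector[OF A] by blast
  obtain H where H: "H \<in> carrier_mat (Suc n) (Suc n)" and Hsym: "transpose_mat H = H"
    and HH: "H * H = 1\<^sub>m (Suc n)" and Hv: "H *\<^sub>v v = unit_vec (Suc n) 0"
    using householder[OF v] by blast
  define B where "B = H * A * H"
  define D where "D = mat n n (\<lambda>(i, j). B $$ (Suc i, Suc j))"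
  define E where "E = mat 1 1 (\<lambda>_. e)"
  have B: "B \<in> carrier_mat (Suc n) (Suc n)" and D: "D \<in> carrier_mat n n"
    and E: "E \<in> carrier_mat 1 1"
    unfolding B_def D_def E_def using A H by auto
  have Bsym: "transpose_mat B = B"
    unfolding B_def using A H sym Hsym by (simp add: transpose_mult[of _ "Suc n" "Suc n" _ "Suc n"])
  have "H *\<^sub>v unit_vec (Suc n) 0 = (H * H) *\<^sub>v v"
    using H v(1) by (simp add: Hv[symmetric])
  hence H0: "H *\<^sub>v unit_vec (Suc n) 0 = v"
    using HH v(1) by simp
  have "B *\<^sub>v unit_vec (Suc n) 0 = H *\<^sub>v (A *\<^sub>v (H *\<^sub>v unit_vec (Suc n) 0))"
    unfolding B_def using A H by (simp add: assoc_mult_mat_vec[of _ "Suc n" "Suc n" _ "Suc n"])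
  also have "\<dots> = e \<cdot>\<^sub>v unit_vec (Suc n) 0"
    unfolding H0 Av using H v(1) Hv by (simp add: mult_mat_vec)
  finally have Bu: "B *\<^sub>v unit_vec (Suc n) 0 = e \<cdot>\<^sub>v unit_vec (Suc n) 0" .
  \<comment> \<open>The first unit vector is an eigenvector of \<open>B\<close>, so the first column
    is zero below \<open>e\<close>; symmetry of \<open>B\<close> then clears the first row as
    well.\<close>
  have col0: "B $$ (i, 0) = (if i = 0 then e else 0)" if "i < Suc n" for i
  proof -
    have "B $$ (i, 0) = (B *\<^sub>v unit_vec (Suc n) 0) $ i" using that B by simp
    thus ?thesis using that Bu by simp
  qed
  have block: "B = four_block_mat E (0\<^sub>m 1 n) (0\<^sub>m n 1) D"
  proof (intro eq_matI)
    fix i j assume "i < dim_row (four_block_mat E (0\<^sub>m 1 n) (0\<^sub>m n 1) D)"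
      "j < dim_col (four_block_mat E (0\<^sub>m 1 n) (0\<^sub>m n 1) D)"
    hence ij: "i < Suc n" "j < Suc n" using D E by auto
    show "B $$ (i, j) = four_block_mat E (0\<^sub>m 1 n) (0\<^sub>m n 1) D $$ (i, j)"
      using ij E D col0[OF ij(1)] col0[OF ij(2)] symmetric_mat_index[OF B Bsym, of i j]
      by (auto simp: E_def D_def)
  qed (use B D E in auto)
  have "similar_mat B A"
    by (rule similar_matI[of _ _ H H "Suc n"]) (use A B H HH in \<open>auto simp: B_def\<close>)
  hence "char_poly A = char_poly B" by (simp add: char_poly_similar)
  also have "\<dots> = char_poly E * char_poly D"
    unfolding block by (rule char_poly_four_block_zeros_col[OF E _ D]) simp
  also have "char_poly E = [:- e, 1:]"
    by (simp add: E_def char_poly_defs det_def sign_def)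
  \<comment> \<open>Cancelling the common factor identifies the characteristic polynomial of
    \<open>D\<close> with the product over the tail of the list, as the induction hypothesis
    requires.\<close>
  finally have "[:- e, 1:] * char_poly D = [:- e, 1:] * (\<Prod>e\<leftarrow>es. [:- e, 1:])"
    using Cons.prems(3) by simp
  hence cpD: "char_poly D = (\<Prod>e\<leftarrow>es. [:- e, 1:])"
    by (metis mult_cancel_left pCons_eq_0_iff zero_neq_one)
  have "transpose_mat D = D"
    using symmetric_mat_index[OF B Bsym] unfolding D_def by (intro eq_matI) auto
  from Cons.IH[OF D this cpD] obtain Q where Q: "Q \<in> carrier_mat n n"
    and QQ: "transpose_mat Q * Q = 1\<^sub>m n"
    and QD: "transpose_mat Q * D * Q = mat_diag n (\<lambda>i. es ! i)" by blast
  define R where "R = four_block_mat (1\<^sub>m 1) (0\<^sub>m 1 n) (0\<^sub>m n 1) Q"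
  have R: "R \<in> carrier_mat (Suc n) (Suc n)" unfolding R_def using Q by auto
  have Rt: "transpose_mat R = four_block_mat (1\<^sub>m 1) (0\<^sub>m 1 n) (0\<^sub>m n 1) (transpose_mat Q)"
    unfolding R_def by (subst transpose_four_block_mat[of _ 1 1 _ n _ n]) (use Q in auto)
  have RR: "transpose_mat R * R = 1\<^sub>m (Suc n)"
    unfolding Rt unfolding R_def
    by (subst mult_four_block_mat[of _ 1 1 _ n _ n _ _ 1 _ n]) (use Q QQ in \<open>auto intro!: eq_matI\<close>)
  have "transpose_mat R * B = four_block_mat E (0\<^sub>m 1 n) (0\<^sub>m n 1) (transpose_mat Q * D)"
    unfolding Rt block
    by (subst mult_four_block_mat[of _ 1 1 _ n _ n _ _ 1 _ n]) (use Q D E in auto)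
  hence "transpose_mat R * B * R
      = four_block_mat E (0\<^sub>m 1 n) (0\<^sub>m n 1) (transpose_mat Q * D) * R" by simp
  also have "\<dots> = four_block_mat E (0\<^sub>m 1 n) (0\<^sub>m n 1) (transpose_mat Q * D * Q)"
    unfolding R_def
    by (subst mult_four_block_mat[of _ 1 1 _ n _ n _ _ 1 _ n]) (use Q D E in auto)
  also have "\<dots> = mat_diag (Suc n) (\<lambda>i. (e # es) ! i)"
    unfolding QD by (intro eq_matI) (auto simp: E_def mat_diag_def)
  finally have RBR: "transpose_mat R * B * R = mat_diag (Suc n) (\<lambda>i. (e # es) ! i)" .
  show ?case
  proof (intro bexI[of _ "H * R"] conjI)
    have "transpose_mat (H * R) * (H * R) = transpose_mat R * (H * H) * R"
      using H R Hsym by (simp add: transpose_mult[of _ "Suc n" "Suc n" _ "Suc n"] assoc_mult_mat[of _ "Suc n" "Suc n" _ "Suc n" _ "Suc n"])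
    thus "transpose_mat (H * R) * (H * R) = 1\<^sub>m m"
      using R RR m by (simp add: HH)
    have "transpose_mat (H * R) * A * (H * R) = transpose_mat R * B * R"
      unfolding B_def using A H R Hsym
      by (simp add: transpose_mult[of _ "Suc n" "Suc n" _ "Suc n"] assoc_mult_mat[of _ "Suc n" "Suc n" _ "Suc n" _ "Suc n"])
    thus "transpose_mat (H * R) * A * (H * R) = mat_diag m (\<lambda>i. (e # es) ! i)"
      using RBR m by simp
  qed (use H R m in auto)
qed

text \<open>The functions \<open>u i\<close> are the columns of the diagonalizing matrix. The three
  properties are read off from the entries of P^T P = 1, of A P = P D and of A = P D P^T, where D is
  the diagonal matrix of \<open>es\<close>.\<close>

lemma symmetric_spectral_decomposition:
  fixes A :: "real mat"
  assumes A: "A \<in> carrier_mat n n" and sym: "transpose_mat A = A"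
    and cp: "char_poly A = (\<Prod>e\<leftarrow>es. [:- e, 1:])"
  obtains u :: "nat \<Rightarrow> nat \<Rightarrow> real"
  where "\<And>i j. i < n \<Longrightarrow> j < n \<Longrightarrow> (\<Sum>p<n. u i p * u j p) = (if i = j then 1 else 0)"
    and "\<And>i p. i < n \<Longrightarrow> p < n \<Longrightarrow> (\<Sum>q<n. A $$ (p, q) * u i q) = es ! i * u i p"
    and "\<And>p. p < n \<Longrightarrow> A $$ (p, p) = (\<Sum>i<n. es ! i * (u i p)\<^sup>2)"
proof -
  obtain P where P: "P \<in> carrier_mat n n" and PtP: "transpose_mat P * P = 1\<^sub>m n"
    and PAP: "transpose_mat P * A * P = mat_diag n (\<lambda>i. es ! i)"
    using symmetric_diagonalization[OF assms] by blast
  have Pt: "transpose_mat P \<in> carrier_mat n n" using P by simp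
  have PPt: "P * transpose_mat P = 1\<^sub>m n"
    by (rule mat_mult_left_right_inverse[OF Pt P PtP])
  have "P * (transpose_mat P * A * P) = (P * transpose_mat P) * A * P"
    using P Pt A by (simp add: assoc_mult_mat[of _ n n _ n _ n])
  hence AP: "A * P = P * mat_diag n (\<lambda>i. es ! i)"
    using A P unfolding PAP PPt by simp
  have "A = A * (P * transpose_mat P)" using A unfolding PPt by simp
  hence A_eq: "A = P * mat_diag n (\<lambda>i. es ! i) * transpose_mat P"
    using P Pt A AP by (simp add: assoc_mult_mat[of _ n n, symmetric])
  show ?thesis
  proof (rule that[of "\<lambda>i p. P $$ (p, i)"])
    fix i j assume "i < n" "j < n"
    thus "(\<Sum>p<n. P $$ (p, i) * P $$ (p, j)) = (if i = j then 1 else 0)"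
      using arg_cong[OF PtP, of "\<lambda>M. M $$ (i, j)"] P by (simp add: scalar_prod_def atLeast0LessThan)
  next
    fix i p assume "i < n" "p < n"
    thus "(\<Sum>q<n. A $$ (p, q) * P $$ (q, i)) = es ! i * P $$ (p, i)"
      using arg_cong[OF AP, of "\<lambda>M. M $$ (p, i)"] P A mat_diag_mult_right[OF P]
      by (simp add: scalar_prod_def atLeast0LessThan mult.commute)
  next
    fix p assume "p < n"
    thus "A $$ (p, p) = (\<Sum>i<n. es ! i * (P $$ (p, i))\<^sup>2)"
      using arg_cong[OF A_eq, of "\<lambda>M. M $$ (p, p)"] P mat_diag_mult_right[OF P]
      by (simp add: scalar_prod_def atLeast0LessThan power2_eq_square mult_ac)
  qed
qed

section \<open>Eigenvalue sums and degrees\<close>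

text \<open>The set is built greedily, adding a maximizer of \<open>d\<close> on the remainder each
  time.\<close>

lemma exists_top_subset:
  fixes d :: "'a \<Rightarrow> real"
  assumes "finite T" "m \<le> card T"
  shows "\<exists>S\<subseteq>T. card S = m \<and> (\<forall>s\<in>S. \<forall>t\<in>T - S. d t \<le> d s)"
  using assms(2)
proof (induction m)
  case (Suc m)
  then obtain S where S: "S \<subseteq> T" "card S = m" "\<forall>s\<in>S. \<forall>t\<in>T - S. d t \<le> d s" by auto
  have fS: "finite S" using S(1) assms(1) finite_subset by blast
  have "T - S \<noteq> {}" using S Suc.prems by auto
  then obtain x where x: "x \<in> T - S" "d x = Max (d ` (T - S))"
    using Max_in[of "d ` (T - S)"] assms(1) by fastforce
  have "\<forall>t\<in>T - S. d t \<le> d x" using x(2) assms(1) by simp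
  thus ?case using S x(1) fS by (intro exI[of _ "insert x S"]) auto
qed (auto intro!: exI[of _ "{}"])

text \<open>With total weight at most \<open>m\<close> and at most 1 per element, the best choice is
  full weight on the \<open>m\<close> largest values. If there are no more than \<open>m\<close>
  elements, all of them are taken, whence only an upper bound on \<open>card S\<close>.\<close>

lemma weighted_sum_le_top_sum:
  fixes d h :: "'a \<Rightarrow> real"
  assumes fin: "finite T" and d: "\<And>t. t \<in> T \<Longrightarrow> 0 \<le> d t"
    and h: "\<And>t. t \<in> T \<Longrightarrow> 0 \<le> h t" "\<And>t. t \<in> T \<Longrightarrow> h t \<le> 1"
    and total: "(\<Sum>t\<in>T. h t) \<le> real m"
  shows "\<exists>S\<subseteq>T. card S \<le> m \<and> (\<Sum>t\<in>T. d t * h t) \<le> (\<Sum>t\<in>S. d t)"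
proof (cases "m < card T")
  case False
  have "(\<Sum>t\<in>T. d t * h t) \<le> (\<Sum>t\<in>T. d t)"
    using d h by (intro sum_mono) (simp add: mult_left_le)
  thus ?thesis using False by (intro exI[of _ T]) auto
next
  case True
  obtain S where S: "S \<subseteq> T" "card S = m" and top: "\<And>s t. s \<in> S \<Longrightarrow> t \<in> T - S \<Longrightarrow> d t \<le> d s"
    using exists_top_subset[OF fin, of m d] True by auto
  have fS: "finite S" using S(1) fin finite_subset by blast
  \<comment> \<open>The threshold \<open>c\<close> separates the values on \<open>S\<close> from
    those outside. After subtracting it from \<open>d\<close>, only elements of \<open>S\<close> can
    contribute positively, and since \<open>c\<close> is nonnegative the correction is at most
    \<open>c * real m\<close>.\<close>
  define c where "c = Max (d ` (T - S))"
  have ne: "T - S \<noteq> {}" using S True fS by auto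
  have fim: "finite (d ` (T - S))" using fin by simp
  have c_in: "c \<in> d ` (T - S)" unfolding c_def using fim ne by (intro Max_in) auto
  have c_ge: "d t \<le> c" if "t \<in> T - S" for t unfolding c_def using fim that by simp
  have c_le: "c \<le> d s" if "s \<in> S" for s using c_in top[OF that] by auto
  have c0: "0 \<le> c" using c_in d by auto
  have "(\<Sum>t\<in>T. d t * h t) = (\<Sum>t\<in>T. (d t - c) * h t) + c * (\<Sum>t\<in>T. h t)"
    by (simp add: sum_distrib_left flip: sum.distrib) (simp add: algebra_simps)
  also have "\<dots> \<le> (\<Sum>t\<in>T. if t \<in> S then d t - c else 0) + c * real m"
  proof (intro add_mono sum_mono mult_left_mono)
    fix t assume t: "t \<in> T"
    show "(d t - c) * h t \<le> (if t \<in> S then d t - c else 0)"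
      using h[OF t] c_le[of t] c_ge[of t] t by (auto simp: mult_left_le mult_nonpos_nonneg)
  qed (use total c0 in auto)
  also have "(\<Sum>t\<in>T. if t \<in> S then d t - c else 0) = (\<Sum>t\<in>S. d t - c)"
    using S(1) fin by (simp add: sum.inter_restrict[symmetric] Int_absorb1)
  also have "\<dots> + c * real m = (\<Sum>t\<in>S. d t)"
    using S(2) by (simp add: sum_subtractf)
  finally show ?thesis using S by auto
qed

section \<open>Double counting of degrees\<close>

lemma le_Suc_choose_two: "n \<le> Suc (n choose 2)"
  by (induction n) (auto simp: numeral_2_eq_2)

text \<open>Counting incidences from the side of \<open>F\<close>, one incidence of each member is
  charged to the member itself and the others to pairs of its neighbours in \<open>S\<close>. By
  \<open>linear\<close>, no pair is charged by two different members, so the pairs of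
  \<open>S\<close> suffice.\<close>

lemma sum_degrees_le:
  assumes fin: "finite S" "finite F"
    and linear: "\<And>a b \<sigma> \<rho>. \<lbrakk>a \<in> S; b \<in> S; a \<noteq> b; \<sigma> \<in> F; \<rho> \<in> F; R a \<sigma>; R b \<sigma>; R a \<rho>; R b \<rho>\<rbrakk>
      \<Longrightarrow> \<sigma> = \<rho>"
  shows "(\<Sum>a\<in>S. card {\<sigma> \<in> F. R a \<sigma>}) \<le> card F + (card S choose 2)"
proof -
  define N where "N \<sigma> = {a \<in> S. R a \<sigma>}" for \<sigma>
  define pairs where "pairs A = {p. p \<subseteq> A \<and> card p = 2}" for A :: "'a set"
  have fN: "finite (N \<sigma>)" for \<sigma> unfolding N_def using fin by simp
  have fpairs: "finite (pairs A)" if "finite A" for A unfolding pairs_def using that by simp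
  have "(\<Sum>a\<in>S. card {\<sigma> \<in> F. R a \<sigma>}) = (\<Sum>a\<in>S. \<Sum>\<sigma>\<in>F. if R a \<sigma> then 1 else 0)"
    using fin by (simp add: sum.inter_filter[symmetric])
  also have "\<dots> = (\<Sum>\<sigma>\<in>F. \<Sum>a\<in>S. if R a \<sigma> then 1 else 0)" by (rule sum.swap)
  also have "\<dots> = (\<Sum>\<sigma>\<in>F. card (N \<sigma>))"
    unfolding N_def using fin by (simp add: sum.inter_filter[symmetric])
  also have "\<dots> \<le> (\<Sum>\<sigma>\<in>F. 1 + card (pairs (N \<sigma>)))"
    unfolding pairs_def using fN le_Suc_choose_two by (intro sum_mono) (simp add: n_subsets)
  also have "\<dots> = card F + (\<Sum>\<sigma>\<in>F. card (pairs (N \<sigma>)))" by (simp only: sum.distrib) simp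
  also have "(\<Sum>\<sigma>\<in>F. card (pairs (N \<sigma>))) = card (\<Union>\<sigma>\<in>F. pairs (N \<sigma>))"
  proof (rule card_UN_disjoint[symmetric])
    show "\<forall>\<sigma>\<in>F. \<forall>\<rho>\<in>F. \<sigma> \<noteq> \<rho> \<longrightarrow> pairs (N \<sigma>) \<inter> pairs (N \<rho>) = {}"
    proof (intro ballI impI equals0I)
      fix \<sigma> \<rho> p assume *: "\<sigma> \<in> F" "\<rho> \<in> F" "\<sigma> \<noteq> \<rho>" "p \<in> pairs (N \<sigma>) \<inter> pairs (N \<rho>)"
      then obtain a b where "p = {a, b}" "a \<noteq> b" unfolding pairs_def by (auto simp: card_2_iff)
      thus False using * linear[of a b \<sigma> \<rho>] unfolding pairs_def N_def by auto
    qed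
  qed (use fin fN fpairs in auto)
  also have "\<dots> \<le> card (pairs S)"
    using fin fpairs by (intro card_mono) (auto simp: pairs_def N_def)
  also have "\<dots> = card S choose 2" unfolding pairs_def using fin by (simp add: n_subsets)
  finally show ?thesis by simp
qed

section \<open>Eigenvalue sums of signed incidence matrices\<close>

lemma Cauchy_Schwarz_sum:
  fixes f g :: "'a \<Rightarrow> real"
  shows "(\<Sum>x\<in>A. f x * g x)\<^sup>2 \<le> (\<Sum>x\<in>A. (f x)\<^sup>2) * (\<Sum>x\<in>A. (g x)\<^sup>2)"
proof -
  have "\<bar>\<Sum>x\<in>A. f x * g x\<bar> \<le> (\<Sum>x\<in>A. \<bar>f x\<bar> * \<bar>g x\<bar>)"
    using sum_abs[of "\<lambda>x. f x * g x" A] by (simp add: abs_mult)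
  also have "\<dots> \<le> L2_set f A * L2_set g A" by (rule L2_set_mult_ineq)
  finally have "(\<Sum>x\<in>A. f x * g x)\<^sup>2 \<le> (L2_set f A * L2_set g A)\<^sup>2"
    by (metis abs_ge_zero power2_abs power_mono)
  thus ?thesis by (simp add: L2_set_def power_mult_distrib sum_nonneg)
qed

text \<open>Here \<open>b\<close> is a matrix B with entries 0, 1 and -1 and support
  \<open>R\<close>, and \<open>y i\<close> is B^T applied to the eigenvector \<open>u i\<close>. The
  weights \<open>h\<close> distribute the eigenvalue sum over the rows in proportion to the degrees
  \<open>d\<close>; once they lie in [0, 1] and have total at most \<open>c * k\<close>, the
  comparison with the largest degrees applies.\<close>

lemma sum_eigenvalues_le_sum_degrees:
  fixes b :: "'a \<Rightarrow> 'b \<Rightarrow> real" and u :: "nat \<Rightarrow> 'a \<Rightarrow> real" and ev :: "nat \<Rightarrow> real"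
  assumes fin: "finite T" "finite F"
    and b: "\<And>t s. t \<in> T \<Longrightarrow> s \<in> F \<Longrightarrow> (b t s)\<^sup>2 = (if R t s then 1 else 0)"
    and size: "\<And>s. s \<in> F \<Longrightarrow> card {t \<in> T. R t s} \<le> c"
    and norm: "\<And>i. i < n \<Longrightarrow> (\<Sum>t\<in>T. (u i t)\<^sup>2) = 1"
    and eig: "\<And>i t. i < n \<Longrightarrow> t \<in> T \<Longrightarrow> (\<Sum>q\<in>T. (\<Sum>s\<in>F. b t s * b q s) * u i q) = ev i * u i t"
    and diag: "\<And>t. t \<in> T \<Longrightarrow> (\<Sum>s\<in>F. (b t s)\<^sup>2) = (\<Sum>i<n. ev i * (u i t)\<^sup>2)"
    and k: "k \<le> n"
  shows "\<exists>S\<subseteq>T. card S \<le> c * k \<and> (\<Sum>i<k. ev i) \<le> (\<Sum>t\<in>S. real (card {s \<in> F. R t s}))"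
proof -
  define y where "y i s = (\<Sum>t\<in>T. b t s * u i t)" for i s
  define d where "d t = real (card {s \<in> F. R t s})" for t
  \<comment> \<open>A row of degree 0 gets weight 0, by the convention for division by zero.\<close>
  define h where "h t = (\<Sum>i<k. ev i * (u i t)\<^sup>2 / d t)" for t
  have b0: "b t s = 0" if "t \<in> T" "s \<in> F" "\<not> R t s" for t s
    using b[OF that(1,2)] that(3) by simp
  have d_eq: "d t = (\<Sum>s\<in>F. (b t s)\<^sup>2)" if "t \<in> T" for t
    using that fin b unfolding d_def by (simp add: sum.inter_filter[symmetric])
  have by_eq: "(\<Sum>s\<in>F. b t s * y i s) = ev i * u i t" if "i < n" "t \<in> T" for i t
  proof -
    have "(\<Sum>s\<in>F. b t s * y i s) = (\<Sum>s\<in>F. \<Sum>q\<in>T. b t s * b q s * u i q)"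
      unfolding y_def by (simp add: sum_distrib_left mult.assoc)
    also have "\<dots> = (\<Sum>q\<in>T. \<Sum>s\<in>F. b t s * b q s * u i q)" by (rule sum.swap)
    finally show ?thesis using eig[OF that] by (simp add: sum_distrib_right)
  qed
  have lam_eq: "ev i = (\<Sum>s\<in>F. (y i s)\<^sup>2)" if "i < n" for i
  proof -
    have "(y i s)\<^sup>2 = (\<Sum>t\<in>T. u i t * (b t s * y i s))" for s
    proof -
      have "(y i s)\<^sup>2 = (\<Sum>t\<in>T. b t s * u i t) * y i s"
        unfolding y_def[symmetric] by (rule power2_eq_square)
      thus ?thesis by (simp add: sum_distrib_left mult_ac)
    qed
    hence "(\<Sum>s\<in>F. (y i s)\<^sup>2) = (\<Sum>s\<in>F. \<Sum>t\<in>T. u i t * (b t s * y i s))"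
      by simp
    also have "\<dots> = (\<Sum>t\<in>T. \<Sum>s\<in>F. u i t * (b t s * y i s))" by (rule sum.swap)
    also have "\<dots> = (\<Sum>t\<in>T. ev i * (u i t)\<^sup>2)"
    proof (intro sum.cong refl)
      fix t assume "t \<in> T"
      have "(\<Sum>s\<in>F. u i t * (b t s * y i s)) = u i t * (\<Sum>s\<in>F. b t s * y i s)"
        by (simp add: sum_distrib_left)
      thus "(\<Sum>s\<in>F. u i t * (b t s * y i s)) = ev i * (u i t)\<^sup>2"
        using by_eq[OF that \<open>t \<in> T\<close>] by (simp add: power2_eq_square)
    qed
    finally show ?thesis using norm[OF that] by (simp flip: sum_distrib_left)
  qed
  have lam0: "0 \<le> ev i" if "i < n" for i using lam_eq[OF that] by (simp add: sum_nonneg)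
  \<comment> \<open>Since all eigenvalues are nonnegative, being squared norms of the
    \<open>y i\<close>, the first \<open>k\<close> terms are at most the full sum, which is the
    diagonal entry.\<close>
  have partial: "(\<Sum>i<k. ev i * (u i t)\<^sup>2) \<le> d t" if "t \<in> T" for t
    unfolding d_eq[OF that] diag[OF that] using k lam0 by (intro sum_mono2) auto
  have h0: "0 \<le> h t" if "t \<in> T" for t
    unfolding h_def using lam0 k by (intro sum_nonneg divide_nonneg_nonneg) (auto simp: d_def)
  have h1: "h t \<le> 1" if "t \<in> T" for t
    using partial[OF that] unfolding h_def
    by (cases "d t = 0") (auto simp: d_def simp flip: sum_divide_distrib)
  have cauchy: "ev i * (u i t)\<^sup>2 / d t * ev i \<le> (\<Sum>s\<in>F. if R t s then (y i s)\<^sup>2 else 0)"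
    if "i < n" "t \<in> T" for i t
  proof -
    \<comment> \<open>Dropping the entries of \<open>y i\<close> outside the support of row
      \<open>t\<close> does not change the product with that row, but it localizes the
      Cauchy-Schwarz bound to the columns that meet \<open>t\<close>.\<close>
    let ?z = "\<lambda>s. if R t s then y i s else 0"
    have "ev i * u i t = (\<Sum>s\<in>F. b t s * ?z s)"
      unfolding by_eq[OF that, symmetric] using b0[OF that(2)] by (intro sum.cong) auto
    hence "(ev i * u i t)\<^sup>2 \<le> d t * (\<Sum>s\<in>F. (?z s)\<^sup>2)"
      unfolding d_eq[OF that(2)] by (simp add: Cauchy_Schwarz_sum)
    also have "(\<Sum>s\<in>F. (?z s)\<^sup>2) = (\<Sum>s\<in>F. if R t s then (y i s)\<^sup>2 else 0)"
      by (intro sum.cong) auto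
    finally have "(ev i * u i t)\<^sup>2 \<le> d t * (\<Sum>s\<in>F. if R t s then (y i s)\<^sup>2 else 0)" .
    moreover have "0 \<le> (\<Sum>s\<in>F. if R t s then (y i s)\<^sup>2 else 0)" by (intro sum_nonneg) auto
    moreover have "0 \<le> d t" unfolding d_def by simp
    ultimately show ?thesis
      by (cases "d t = 0") (auto simp: field_simps power2_eq_square)
  qed
  \<comment> \<open>Summing the localized bounds over \<open>t\<close> counts each squared entry of
    \<open>y i\<close> at most \<open>c\<close> times, hence gives at most \<open>c\<close> times
    \<open>ev i\<close>. A nonzero \<open>ev i\<close> cancels; for \<open>ev i = 0\<close> the left
    side is 0.\<close>
  have column: "(\<Sum>t\<in>T. ev i * (u i t)\<^sup>2 / d t) \<le> real c" if "i < n" for i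
  proof (cases "ev i = 0")
    case False
    have "(\<Sum>t\<in>T. ev i * (u i t)\<^sup>2 / d t) * ev i \<le> (\<Sum>t\<in>T. \<Sum>s\<in>F. if R t s then (y i s)\<^sup>2 else 0)"
      unfolding sum_distrib_right using cauchy[OF that] by (intro sum_mono) auto
    also have "\<dots> = (\<Sum>s\<in>F. \<Sum>t\<in>T. if R t s then (y i s)\<^sup>2 else 0)" by (rule sum.swap)
    also have "\<dots> = (\<Sum>s\<in>F. real (card {t \<in> T. R t s}) * (y i s)\<^sup>2)"
      using fin by (simp add: sum.inter_filter[symmetric])
    also have "\<dots> \<le> (\<Sum>s\<in>F. real c * (y i s)\<^sup>2)"
      using size by (intro sum_mono mult_right_mono) auto
    also have "\<dots> = real c * ev i" unfolding lam_eq[OF that] by (simp add: sum_distrib_left)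
    finally show ?thesis using False lam0[OF that] by simp
  qed simp
  have "(\<Sum>t\<in>T. h t) = (\<Sum>i<k. \<Sum>t\<in>T. ev i * (u i t)\<^sup>2 / d t)"
    unfolding h_def by (rule sum.swap)
  also have "\<dots> \<le> (\<Sum>i<k. real c)" using column k by (intro sum_mono) auto
  finally have total: "(\<Sum>t\<in>T. h t) \<le> real (c * k)" by (simp add: mult.commute)
  \<comment> \<open>In a row of degree 0 the division loses nothing: the partial sum is squeezed
    between 0 and \<open>d t\<close>.\<close>
  have dh: "d t * h t = (\<Sum>i<k. ev i * (u i t)\<^sup>2)" if "t \<in> T" for t
  proof (cases "d t = 0")
    case True
    have "0 \<le> (\<Sum>i<k. ev i * (u i t)\<^sup>2)" using lam0 k by (intro sum_nonneg) auto
    thus ?thesis using True partial[OF that] by simp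
  qed (simp add: h_def flip: sum_divide_distrib)
  have "(\<Sum>t\<in>T. d t * h t) = (\<Sum>t\<in>T. \<Sum>i<k. ev i * (u i t)\<^sup>2)"
    by (intro sum.cong) (simp_all add: dh)
  also have "\<dots> = (\<Sum>i<k. \<Sum>t\<in>T. ev i * (u i t)\<^sup>2)" by (rule sum.swap)
  also have "\<dots> = (\<Sum>i<k. ev i)" using norm k by (simp flip: sum_distrib_left)
  finally have "(\<Sum>i<k. ev i) = (\<Sum>t\<in>T. d t * h t)" ..
  thus ?thesis
    using weighted_sum_le_top_sum[OF fin(1) _ h0 h1 total, of d] unfolding d_def by simp
qed

section \<open>The upper Laplacian\<close>

text \<open>For an r-face \<open>\<sigma>\<close> and an (r-1)-face \<open>\<tau>\<close> this is
  the entry of the simplicial boundary matrix, with the row index first; the arguments of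
  \<open>incidence_sign\<close> come in the opposite order.\<close>

definition boundary_coeff :: "'a::linorder set \<Rightarrow> 'a set \<Rightarrow> real" where
  "boundary_coeff \<tau> \<sigma> = (if \<tau> \<subseteq> \<sigma> then incidence_sign \<sigma> \<tau> else 0)"

lemma boundary_coeff_square: "(boundary_coeff \<tau> \<sigma>)\<^sup>2 = (if \<tau> \<subseteq> \<sigma> then 1 else 0)"
  by (simp add: boundary_coeff_def incidence_sign_def flip: power_mult)

lemma incidence_sign_insert:
  assumes "u \<notin> \<sigma>"
  shows "incidence_sign (insert u \<sigma>) \<sigma> = (-1) ^ card {v \<in> \<sigma>. v < u}"
proof -
  have "insert u \<sigma> - \<sigma> = {u}" using assms by auto
  moreover have "{v \<in> insert u \<sigma>. v < u} = {v \<in> \<sigma>. v < u}" by auto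
  ultimately show ?thesis by (simp add: incidence_sign_def)
qed

text \<open>For x < y, adding \<open>y\<close> to \<open>\<rho>\<close> leaves the number of
  vertices below \<open>x\<close> unchanged, while adding \<open>x\<close> raises the number below
  \<open>y\<close> by one, so exactly one sign flips. This is the cancellation that makes the
  boundary of a boundary vanish.\<close>

lemma incidence_sign_swap:
  assumes "finite \<rho>" "x \<notin> \<rho>" "y \<notin> \<rho>" "x \<noteq> y"
  shows "incidence_sign (insert x (insert y \<rho>)) (insert y \<rho>) * incidence_sign (insert x (insert y \<rho>)) (insert x \<rho>)
    = - incidence_sign (insert x \<rho>) \<rho> * incidence_sign (insert y \<rho>) \<rho>"
  using assms(2-)
proof (induction x y rule: linorder_wlog)
  case (le x y)
  have "{v \<in> insert y \<rho>. v < x} = {v \<in> \<rho>. v < x}" using le by auto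
  moreover have "{v \<in> insert x \<rho>. v < y} = insert x {v \<in> \<rho>. v < y}" using le by auto
  ultimately show ?case
    using le assms(1) incidence_sign_insert[of x "insert y \<rho>"] incidence_sign_insert[of y "insert x \<rho>"]
      incidence_sign_insert[of x \<rho>] incidence_sign_insert[of y \<rho>]
    by (simp add: insert_commute[of y x])
qed (simp add: insert_commute mult.commute)

text \<open>The union of two distinct r-sets has more than r elements, so it fills
  \<open>\<sigma>\<close>. This leaves at most one term in each off-diagonal entry of B B^T, and it
  makes two (r-1)-faces share at most one r-face.\<close>

lemma facet_pair_union:
  assumes "finite \<sigma>" "card \<sigma> = Suc r" "card \<tau> = r" "card \<eta> = r" "\<tau> \<noteq> \<eta>" "\<tau> \<subseteq> \<sigma>" "\<eta> \<subseteq> \<sigma>"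
  shows "\<sigma> = \<tau> \<union> \<eta>"
proof -
  have fin: "finite \<tau>" "finite \<eta>" using assms finite_subset by blast+
  have "\<tau> \<subset> \<tau> \<union> \<eta>" using assms fin card_subset_eq[of \<tau> \<eta>] card_subset_eq[of \<eta> \<tau>] by auto
  hence "card \<sigma> \<le> card (\<tau> \<union> \<eta>)" using psubset_card_mono[of "\<tau> \<union> \<eta>" \<tau>] fin assms by simp
  thus ?thesis using card_seteq[of \<sigma> "\<tau> \<union> \<eta>"] assms by auto
qed

section \<open>The Laplacian as a product B B^T\<close>

lemma simplicial_complex_finite:
  assumes "simplicial_complex V X"
  shows "finite X" "\<And>\<sigma>. \<sigma> \<in> X \<Longrightarrow> finite \<sigma>"
  using assms unfolding simplicial_complex_def by (meson finite_Pow_iff finite_subset PowD subsetD)+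

lemma faces_iff: "1 \<le> r \<Longrightarrow> \<tau> \<in> faces X (int r - 1) \<longleftrightarrow> \<tau> \<in> X \<and> card \<tau> = r"
  and faces_iff': "\<sigma> \<in> faces X (int r) \<longleftrightarrow> \<sigma> \<in> X \<and> card \<sigma> = Suc r"
  by (auto simp: faces_def simplex_dim_def)

text \<open>On the diagonal the squares count the r-faces above \<open>\<tau>\<close>. Off the
  diagonal only the union of the two faces can contribute, and \<open>incidence_sign_swap\<close>
  turns its signs into those relative to the intersection.\<close>

lemma upper_laplacian_entry_eq:
  assumes X: "simplicial_complex V X" and r: "1 \<le> r"
    and \<tau>: "\<tau> \<in> faces X (int r - 1)" and \<eta>: "\<eta> \<in> faces X (int r - 1)"
  shows "upper_laplacian_entry X r \<tau> \<eta>
    = (\<Sum>\<sigma>\<in>faces X (int r). boundary_coeff \<tau> \<sigma> * boundary_coeff \<eta> \<sigma>)"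
proof -
  let ?F = "faces X (int r)"
  note fin = simplicial_complex_finite[OF X]
  have finF: "finite ?F" using fin(1) by (simp add: faces_def)
  have c: "\<tau> \<in> X" "card \<tau> = r" "\<eta> \<in> X" "card \<eta> = r" using \<tau> \<eta> faces_iff[OF r] by auto
  show ?thesis
  proof (cases "\<tau> = \<eta>")
    case True
    thus ?thesis
      using finF by (simp add: upper_laplacian_entry_def face_degree_def boundary_coeff_square
          sum.inter_filter[symmetric] flip: power2_eq_square)
  next
    case False
    have zero: "boundary_coeff \<tau> \<sigma> * boundary_coeff \<eta> \<sigma> = 0" if "\<sigma> \<in> ?F" "\<sigma> \<noteq> \<tau> \<union> \<eta>" for \<sigma>
      using that facet_pair_union[of \<sigma> r \<tau> \<eta>] c False fin(2)
      by (auto simp: boundary_coeff_def faces_iff')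
    have "(\<Sum>\<sigma>\<in>?F. boundary_coeff \<tau> \<sigma> * boundary_coeff \<eta> \<sigma>)
        = (\<Sum>\<sigma>\<in>?F. if \<sigma> = \<tau> \<union> \<eta> then boundary_coeff \<tau> \<sigma> * boundary_coeff \<eta> \<sigma> else 0)"
      by (intro sum.cong) (auto simp: zero)
    also have "\<dots> = (if \<tau> \<union> \<eta> \<in> ?F then incidence_sign (\<tau> \<union> \<eta>) \<tau> * incidence_sign (\<tau> \<union> \<eta>) \<eta> else 0)"
      using finF by (simp add: boundary_coeff_def)
    also have "\<dots> = upper_laplacian_entry X r \<tau> \<eta>"
    proof -
      have "card (\<tau> \<union> \<eta>) + card (\<tau> \<inter> \<eta>) = 2 * r"
        using card_Un_Int[of \<tau> \<eta>] fin(2) c by simp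
      hence iff: "\<tau> \<union> \<eta> \<in> ?F \<longleftrightarrow> card (\<tau> \<inter> \<eta>) = r - 1 \<and> \<tau> \<union> \<eta> \<in> X"
        using r by (auto simp: faces_iff')
      have "incidence_sign (\<tau> \<union> \<eta>) \<tau> * incidence_sign (\<tau> \<union> \<eta>) \<eta>
          = - incidence_sign \<tau> (\<tau> \<inter> \<eta>) * incidence_sign \<eta> (\<tau> \<inter> \<eta>)" if int: "card (\<tau> \<inter> \<eta>) = r - 1"
      proof -
        have "card (\<tau> - \<eta>) = 1" "card (\<eta> - \<tau>) = 1"
          using card_Diff_subset_Int[of \<tau> \<eta>] card_Diff_subset_Int[of \<eta> \<tau>] fin(2) c int r
          by (auto simp: Int_commute)
        then obtain x y where xy: "\<tau> - \<eta> = {x}" "\<eta> - \<tau> = {y}" by (auto simp: card_1_singleton_iff)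
        define \<rho> where "\<rho> = \<tau> \<inter> \<eta>"
        have eqs: "\<tau> = insert x \<rho>" "\<eta> = insert y \<rho>" "\<tau> \<union> \<eta> = insert y (insert x \<rho>)"
          and side: "x \<notin> \<rho>" "y \<notin> \<rho>" "y \<noteq> x" and "finite \<rho>"
          using xy c fin(2) unfolding \<rho>_def by auto
        show ?thesis
          using incidence_sign_swap[OF \<open>finite \<rho>\<close> side(2,1,3)]
          unfolding \<rho>_def[symmetric] eqs(3) unfolding eqs(1,2) by (simp add: mult.commute)
      qed
      thus ?thesis using False by (simp add: upper_laplacian_entry_def iff)
    qed
    finally show ?thesis ..
  qed
qed

text \<open>Any list of linear factors is a permutation of the multiset of roots, so the roots may
  be listed in the decreasing order used by \<open>nth_largest_eigenvalue\<close>.\<close>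

lemma prod_linear_factors_sorted_proots:
  fixes p :: "real poly"
  assumes "p = (\<Prod>e\<leftarrow>es. [:- e, 1:])"
  shows "p = (\<Prod>e\<leftarrow>rev (sorted_list_of_multiset (proots p)). [:- e, 1:])"
proof -
  have "0 \<notin> set (map (\<lambda>e. [:- e, 1:]) es)" by auto
  with proots_prod_list[of "map (\<lambda>e. [:- e, 1:]) es"]
  have "proots p = (\<Sum>q\<leftarrow>map (\<lambda>e. [:- e, 1:]) es. proots q)"
    unfolding assms list.map_ident by blast
  also have "\<dots> = mset es" by (induction es) auto
  finally have "mset (rev (sorted_list_of_multiset (proots p))) = mset es" by simp
  hence "mset (map (\<lambda>e. [:- e, 1:]) (rev (sorted_list_of_multiset (proots p))))
      = mset (map (\<lambda>e. [:- e, 1:]) es)" by (simp only: mset_map)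
  hence "(\<Prod>e\<leftarrow>rev (sorted_list_of_multiset (proots p)). [:- e, 1:]) = (\<Prod>e\<leftarrow>es. [:- e, 1:])"
    by (simp only: prod_mset_prod_list[symmetric])
  thus ?thesis unfolding assms[symmetric] by (rule sym)
qed

text \<open>Distinctness lets the indices inject into the r-subsets of \<open>\<sigma>\<close>. This
  is the source of the factor r + 1 in the theorem.\<close>

lemma card_facets_le:
  assumes "distinct fs" "\<And>\<tau>. \<tau> \<in> set fs \<Longrightarrow> card \<tau> = r" "finite \<sigma>" "card \<sigma> = Suc r"
  shows "card {i \<in> {..<length fs}. fs ! i \<subseteq> \<sigma>} \<le> Suc r"
proof -
  have "card {i \<in> {..<length fs}. fs ! i \<subseteq> \<sigma>} \<le> card {\<tau>. \<tau> \<subseteq> \<sigma> \<and> card \<tau> = r}"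
  proof (rule card_inj_on_le)
    show "inj_on ((!) fs) {i \<in> {..<length fs}. fs ! i \<subseteq> \<sigma>}"
      using assms(1) by (auto simp: inj_on_def nth_eq_iff_index_eq)
  qed (use assms in auto)
  also have "\<dots> = Suc r" using assms(3,4) by (simp add: n_subsets)
  finally show ?thesis .
qed

theorem corollary1p7:
  fixes V :: "'a::linorder set" and X :: "'a set set" and fs :: "'a set list" and r k :: nat
  assumes "simplicial_complex V X"
    and "1 \<le> r" and "int r \<le> complex_dim X"
    and "distinct fs" and "set fs = faces X (int r - 1)"
    and "1 \<le> k" and "k \<le> face_number X (int r - 1)"
  shows "(\<Sum>i = 1..k. nth_largest_eigenvalue (upper_laplacian X r fs) i)
         \<le> real (face_number X (int r)) + real (((r + 1) * k) choose 2)"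
proof -
  define F where "F = faces X (int r)"
  define n where "n = length fs"
  define A where "A = upper_laplacian X r fs"
  define es where "es = rev (sorted_list_of_multiset (proots (char_poly A)))"
  define b where "b p = boundary_coeff (fs ! p)" for p
  define R where "R p \<sigma> \<longleftrightarrow> fs ! p \<subseteq> \<sigma>" for p \<sigma>
  note X = assms(1) and r = assms(2)
  note fin = simplicial_complex_finite[OF X]
  have finF: "finite F" unfolding F_def faces_def using fin(1) by simp
  have fs: "fs ! p \<in> faces X (int r - 1)" if "p < n" for p
    using that assms(5) nth_mem unfolding n_def by blast
  have card_fs: "card (fs ! p) = r" if "p < n" for p
    using fs[OF that] faces_iff[OF r] by blast
  have F: "finite \<sigma>" "card \<sigma> = Suc r" if "\<sigma> \<in> F" for \<sigma>
    using that fin(2) unfolding F_def faces_iff' by auto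
  have kn: "k \<le> n"
    using assms(4,5,7) unfolding n_def face_number_def by (simp add: distinct_card flip: assms(5))
  have A: "A \<in> carrier_mat n n" unfolding A_def upper_laplacian_def n_def by simp
  have entry: "A $$ (p, q) = (\<Sum>\<sigma>\<in>F. b p \<sigma> * b q \<sigma>)" if "p < n" "q < n" for p q
    using that upper_laplacian_entry_eq[OF X r fs fs]
    unfolding A_def upper_laplacian_def n_def F_def b_def by simp
  have sym: "transpose_mat A = A"
    using A by (intro eq_matI) (auto simp: entry mult.commute)
  obtain es' where "char_poly A = (\<Prod>e\<leftarrow>es'. [:- e, 1:])"
    using symmetric_char_poly_splits[OF A sym] by blast
  \<comment> \<open>The factorization is passed on in decreasing order, so that \<open>u i\<close>
    belongs to the eigenvalue \<open>es ! i\<close> and the first \<open>k\<close> indices give the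
    \<open>k\<close> largest eigenvalues.\<close>
  hence cp: "char_poly A = (\<Prod>e\<leftarrow>es. [:- e, 1:])"
    unfolding es_def by (rule prod_linear_factors_sorted_proots)
  obtain u :: "nat \<Rightarrow> nat \<Rightarrow> real"
    where u: "\<And>i j. i < n \<Longrightarrow> j < n \<Longrightarrow> (\<Sum>p<n. u i p * u j p) = (if i = j then 1 else 0)"
      "\<And>i p. i < n \<Longrightarrow> p < n \<Longrightarrow> (\<Sum>q<n. A $$ (p, q) * u i q) = es ! i * u i p"
      "\<And>p. p < n \<Longrightarrow> A $$ (p, p) = (\<Sum>i<n. es ! i * (u i p)\<^sup>2)"
    using symmetric_spectral_decomposition[OF A sym cp] by blast
  have "\<exists>S\<subseteq>{..<n}. card S \<le> Suc r * k
      \<and> (\<Sum>i<k. es ! i) \<le> (\<Sum>p\<in>S. real (card {\<sigma> \<in> F. R p \<sigma>}))"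
  \<comment> \<open>The rows are the positions \<open>p\<close> in \<open>fs\<close>, the columns
    are the r-faces, and the column bound \<open>c\<close> is the number \<open>Suc r\<close> of
    facets.\<close>
  proof (rule sum_eigenvalues_le_sum_degrees[where b = b and u = u and n = n])
    show "(b p \<sigma>)\<^sup>2 = (if R p \<sigma> then 1 else 0)" for p \<sigma>
      unfolding b_def R_def by (rule boundary_coeff_square)
    show "card {p \<in> {..<n}. R p \<sigma>} \<le> Suc r" if "\<sigma> \<in> F" for \<sigma>
      unfolding n_def R_def using faces_iff[OF r] assms(5)
      by (intro card_facets_le[OF assms(4) _ F[OF that]]) blast
    show "(\<Sum>p<n. (u i p)\<^sup>2) = 1" if "i < n" for i
      using u(1)[OF that that] by (simp add: power2_eq_square)
    show "(\<Sum>q<n. (\<Sum>\<sigma>\<in>F. b p \<sigma> * b q \<sigma>) * u i q) = es ! i * u i p" if "i < n" "p \<in> {..<n}" for i p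
      using u(2)[of i p] that by (simp add: entry)
    show "(\<Sum>\<sigma>\<in>F. (b p \<sigma>)\<^sup>2) = (\<Sum>i<n. es ! i * (u i p)\<^sup>2)" if "p \<in> {..<n}" for p
      using u(3)[of p] that by (simp add: entry power2_eq_square)
  qed (use finF kn in auto)
  then obtain S where S: "S \<subseteq> {..<n}" "card S \<le> Suc r * k"
    and bound: "(\<Sum>i<k. es ! i) \<le> (\<Sum>p\<in>S. real (card {\<sigma> \<in> F. R p \<sigma>}))" by blast
  have "(\<Sum>p\<in>S. card {\<sigma> \<in> F. R p \<sigma>}) \<le> card F + (card S choose 2)"
  proof (rule sum_degrees_le)
    show "finite S" using S(1) finite_subset by blast
    fix p q \<sigma> \<rho>
    assume "p \<in> S" "q \<in> S" "p \<noteq> q" and F': "\<sigma> \<in> F" "\<rho> \<in> F"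
      and R: "R p \<sigma>" "R q \<sigma>" "R p \<rho>" "R q \<rho>"
    hence pq: "p < n" "q < n" and ne: "fs ! p \<noteq> fs ! q"
      using S(1) nth_eq_iff_index_eq[OF assms(4), of p q] unfolding n_def by auto
    have "\<sigma> = fs ! p \<union> fs ! q" "\<rho> = fs ! p \<union> fs ! q"
      using facet_pair_union[OF F[OF F'(1)] card_fs[OF pq(1)] card_fs[OF pq(2)] ne]
        facet_pair_union[OF F[OF F'(2)] card_fs[OF pq(1)] card_fs[OF pq(2)] ne] R
      unfolding R_def by blast+
    thus "\<sigma> = \<rho>" by simp
  qed (fact finF)
  also have "\<dots> \<le> card F + ((Suc r * k) choose 2)"
    using binomial_right_mono[OF S(2)] by simp
  finally have "(\<Sum>p\<in>S. real (card {\<sigma> \<in> F. R p \<sigma>})) \<le> real (card F) + real ((Suc r * k) choose 2)"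
    by (simp only: of_nat_sum[symmetric] of_nat_add[symmetric] of_nat_le_iff)
  \<comment> \<open>Eigenvalues are numbered from 1 and list positions from 0.\<close>
  moreover have "(\<Sum>i = 1..k. nth_largest_eigenvalue A i) = (\<Sum>i<k. es ! i)"
    unfolding nth_largest_eigenvalue_def es_def[symmetric] by (simp add: sum.atLeast1_atMost_eq)
  ultimately show ?thesis
    using bound unfolding A_def F_def face_number_def by simp
qed

end
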